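(* Let $D\subset\mathbb{R}$, $\varepsilon\geq 0$ and assume that a function $f\colon D\to\mathbb{R}$ satisfies $$\max\{f(x),f(y)\}-f(\max\{x,y\})\leq\varepsilon\quad\text{for all }x,y\in D.$$ Then there exists an increasing function $g\colon D\to \mathbb{R}$ such that $|f(x)-g(x)|\leq\varepsilon/2$ for every $x\in D$.
   Context: "Increasing" is meant in the weak sense: $g\colon D\to\mathbb{R}$ is increasing if $x\leq y$ implies $g(x)\leq g(y)$ for $x,y\in D$ (equivalently, $\max\{g(x),g(y)\}=g(\max\{x,y\})$ for all $x,y\in D$). *)

theory Defs
  imports Complex_Main
begin

end

theory Submission
  imports Defs
begin

text \<open>The running supremum of \<open>f\<close> is increasing and, by the hypothesis, lies between \<open>f\<close> and
  \<open>f + \<epsilon>\<close>; shifting it down by \<open>\<epsilon> / 2\<close> centres the error.\<close>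

theorem corollary10:
  fixes D :: "real set" and f :: "real \<Rightarrow> real" and \<epsilon> :: real
  assumes "\<epsilon> \<ge> 0"
    and "\<forall>x\<in>D. \<forall>y\<in>D. max (f x) (f y) - f (max x y) \<le> \<epsilon>"
  shows "\<exists>g :: real \<Rightarrow> real. mono_on D g \<and> (\<forall>x\<in>D. \<bar>f x - g x\<bar> \<le> \<epsilon> / 2)"
proof -
  define S where "S x = f ` {y \<in> D. y \<le> x}" for x
  \<comment> \<open>For \<open>y \<le> x\<close> the term \<open>max x y\<close> collapses to
    \<open>x\<close>, so the hypothesis bounds \<open>f y\<close> by
    \<open>f x + \<epsilon>\<close>. This one estimate serves both \<open>bdd\<close> and
    \<open>upper\<close>.\<close>
  have bound: "z \<le> f x + \<epsilon>" if "x \<in> D" "z \<in> S x" for x z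
  proof -
    obtain y where "y \<in> D" "y \<le> x" "z = f y"
      using \<open>z \<in> S x\<close> unfolding S_def by blast
    moreover have "max (f x) (f y) - f (max x y) \<le> \<epsilon>"
      using assms(2) \<open>x \<in> D\<close> \<open>y \<in> D\<close> by blast
    ultimately show ?thesis by (simp add: max_absorb1)
  qed
  have bdd: "bdd_above (S x)" if "x \<in> D" for x
    using bound[OF that] by (rule bdd_aboveI)
  \<comment> \<open>Besides yielding \<open>lower\<close>, this makes \<open>S x\<close> nonempty;
    with \<open>bdd\<close> it ensures that the real \<open>Sup\<close> is a genuine least upper
    bound at points of \<open>D\<close>.\<close>
  have self: "f x \<in> S x" if "x \<in> D" for x
    using that by (simp add: S_def)
  have lower: "f x \<le> Sup (S x)" if "x \<in> D" for x
    using self[OF that] bdd[OF that] by (rule cSup_upper)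
  have upper: "Sup (S x) \<le> f x + \<epsilon>" if "x \<in> D" for x
    using self[OF that] bound[OF that] by (intro cSup_least) auto
  have "mono_on D (\<lambda>x. Sup (S x) - \<epsilon> / 2)"
  proof (rule mono_onI)
    fix x y assume "x \<in> D" "y \<in> D" "x \<le> y"
    moreover from \<open>x \<le> y\<close> have "S x \<subseteq> S y"
      by (auto simp: S_def)
    \<comment> \<open>Comparing the suprema takes \<open>S x\<close> nonempty (from
      \<open>x \<in> D\<close>) and \<open>S y\<close> bounded above (from
      \<open>y \<in> D\<close>).\<close>
    ultimately have "Sup (S x) \<le> Sup (S y)"
      using self bdd by (intro cSup_subset_mono) auto
    then show "Sup (S x) - \<epsilon> / 2 \<le> Sup (S y) - \<epsilon> / 2" by simp
  qed
  moreover have "\<bar>f x - (Sup (S x) - \<epsilon> / 2)\<bar> \<le> \<epsilon> / 2" if "x \<in> D" for x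
    using lower[OF that] upper[OF that] by (simp add: abs_le_iff field_simps)
  ultimately show ?thesis by blast
qed

end
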